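(* Let $(X,r)$ be a solution and let $n$ be a positive integer. Then $(X,r)$ is $n$-decomposable if and only if its injectivization $\mathrm{Inj}(X,r)$ is $n$-decomposable. In particular, $(X,r)$ is decomposable if and only if $\mathrm{Inj}(X,r)$ is decomposable.
   Context: "Solution" means finite bijective non-degenerate set-theoretic solution of the Yang--Baxter equation: a pair $(X,r)$ with $X$ a non-empty finite set and $r:X\times X\to X\times X$, $r(x,y)=(\lambda_x(y),\rho_y(x))$, a bijection such that $(r\times \mathrm{id}_X)(\mathrm{id}_X\times r)(r\times \mathrm{id}_X)=(\mathrm{id}_X\times r)(r\times \mathrm{id}_X)(\mathrm{id}_X\times r)$ and all maps $\lambda_x,\rho_x:X\to X$ are bijective. A subsolution of $(X,r)$ is a non-empty subset $Y\subseteq X$ with $r(Y\times Y)\subseteq Y\times Y$, endowed with the restriction of $r$. $(X,r)$ is $n$-decomposable if there are $n$ subsolutions $(X_1,r_1),\dots,(X_n,r_n)$ such that $\{X_1,\dots,X_n\}$ is a partition of $X$ and $r(X_i\times X_j)=X_j\times X_i$ for all $i,j\in\{1,\dots,n\}$. $(X,r)$ is decomposable if there is a partition $X=Y\cup Z$ with $Y,Z\ne\emptyset$ such that $r(Y\times Y)\subseteq Y\times Y$ and $r(Z\times Z)\subseteq Z\times Z$. The Yang--Baxter group is $G(X,r)=\langle x\in X\mid x\circ y=\lambda_x(y)\circ\rho_y(x)\text{ for all }x,y\in X\rangle$, and $i:X\to G(X,r)$ is the canonical map sending each $x$ to the corresponding generator. The injectivization $\mathrm{Inj}(X,r)$ is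 the solution on the set $i(X)$ induced by $r$, i.e. $(i(x),i(y))\mapsto (i(\lambda_x(y)),i(\rho_y(x)))$, which is well defined (it is the restriction to $i(X)$ of the canonical extension $r_G$ of this solution to $G(X,r)$). *)

theory Defs
  imports "HOL-Algebra.Group" "HOL-Library.Disjoint_Sets"
begin

section \<open>Set-theoretic solutions of the Yang--Baxter equation\<close>

text \<open>A map \<open>r : X \<times> X \<rightarrow> X \<times> X\<close> is a total HOL function of which only the values on
  \<open>X \<times> X\<close> matter. We write \<open>r (x, y) = (lam r x y, rho r y x)\<close>.\<close>

abbreviation lam :: "('a \<times> 'a \<Rightarrow> 'a \<times> 'a) \<Rightarrow> 'a \<Rightarrow> 'a \<Rightarrow> 'a" where
  "lam r x y \<equiv> fst (r (x, y))"

abbreviation rho :: "('a \<times> 'a \<Rightarrow> 'a \<times> 'a) \<Rightarrow> 'a \<Rightarrow> 'a \<Rightarrow> 'a" where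
  "rho r y x \<equiv> snd (r (x, y))"

text \<open>\<open>r \<times> id\<close> and \<open>id \<times> r\<close> on triples; triples are nested to the right.\<close>

definition r12 :: "('a \<times> 'a \<Rightarrow> 'a \<times> 'a) \<Rightarrow> 'a \<times> 'a \<times> 'a \<Rightarrow> 'a \<times> 'a \<times> 'a" where
  "r12 r = (\<lambda>(x, y, z). (lam r x y, rho r y x, z))"

definition r23 :: "('a \<times> 'a \<Rightarrow> 'a \<times> 'a) \<Rightarrow> 'a \<times> 'a \<times> 'a \<Rightarrow> 'a \<times> 'a \<times> 'a" where
  "r23 r = map_prod id r"

definition yb_solution :: "'a set \<Rightarrow> ('a \<times> 'a \<Rightarrow> 'a \<times> 'a) \<Rightarrow> bool" where
  "yb_solution X r \<longleftrightarrow>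
     finite X \<and> X \<noteq> {} \<and> bij_betw r (X \<times> X) (X \<times> X) \<and>
     (\<forall>t \<in> X \<times> X \<times> X. r12 r (r23 r (r12 r t)) = r23 r (r12 r (r23 r t))) \<and>
     (\<forall>x \<in> X. bij_betw (lam r x) X X) \<and>
     (\<forall>y \<in> X. bij_betw (rho r y) X X)"

definition subsolution :: "'a set \<Rightarrow> 'a set \<Rightarrow> ('a \<times> 'a \<Rightarrow> 'a \<times> 'a) \<Rightarrow> bool" where
  "subsolution Y X r \<longleftrightarrow> Y \<noteq> {} \<and> Y \<subseteq> X \<and> r ` (Y \<times> Y) \<subseteq> Y \<times> Y"

text \<open>Injectivity of \<open>P\<close> says that the \<open>n\<close> blocks of the partition are pairwise different.\<close>

definition n_decomposable :: "nat \<Rightarrow> 'a set \<Rightarrow> ('a \<times> 'a \<Rightarrow> 'a \<times> 'a) \<Rightarrow> bool" where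
  "n_decomposable n X r \<longleftrightarrow>
     (\<exists>P :: nat \<Rightarrow> 'a set.
        (\<forall>i \<in> {1..n}. subsolution (P i) X r) \<and>
        partition_on X (P ` {1..n}) \<and> inj_on P {1..n} \<and>
        (\<forall>i \<in> {1..n}. \<forall>j \<in> {1..n}. r ` (P i \<times> P j) = P j \<times> P i))"

definition decomposable :: "'a set \<Rightarrow> ('a \<times> 'a \<Rightarrow> 'a \<times> 'a) \<Rightarrow> bool" where
  "decomposable X r \<longleftrightarrow>
     (\<exists>Y Z. X = Y \<union> Z \<and> Y \<inter> Z = {} \<and> Y \<noteq> {} \<and> Z \<noteq> {} \<and>
        r ` (Y \<times> Y) \<subseteq> Y \<times> Y \<and> r ` (Z \<times> Z) \<subseteq> Z \<times> Z)"

section \<open>Groups given by generators and relations\<close>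

text \<open>A letter \<open>(x, True)\<close> stands for the generator \<open>x\<close>, and \<open>(x, False)\<close> for its inverse.\<close>

type_synonym 'a word = "('a \<times> bool) list"

text \<open>The congruence on words over \<open>S\<close> generated by free cancellation and by the pairs in \<open>R\<close>.\<close>

inductive_set pres_rel :: "'a set \<Rightarrow> ('a word \<times> 'a word) set \<Rightarrow> ('a word \<times> 'a word) set"
  for S :: "'a set" and R :: "('a word \<times> 'a word) set" where
  refl: "u \<in> lists (S \<times> UNIV) \<Longrightarrow> (u, u) \<in> pres_rel S R"
| sym: "(u, v) \<in> pres_rel S R \<Longrightarrow> (v, u) \<in> pres_rel S R"
| trans: "(u, v) \<in> pres_rel S R \<Longrightarrow> (v, w) \<in> pres_rel S R \<Longrightarrow> (u, w) \<in> pres_rel S R"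
| append: "(u, u') \<in> pres_rel S R \<Longrightarrow> (v, v') \<in> pres_rel S R \<Longrightarrow> (u @ v, u' @ v') \<in> pres_rel S R"
| cancel: "x \<in> S \<Longrightarrow> ([(x, b), (x, \<not> b)], []) \<in> pres_rel S R"
| rel: "(u, v) \<in> R \<Longrightarrow> u \<in> lists (S \<times> UNIV) \<Longrightarrow> v \<in> lists (S \<times> UNIV) \<Longrightarrow> (u, v) \<in> pres_rel S R"

definition presented_group :: "'a set \<Rightarrow> ('a word \<times> 'a word) set \<Rightarrow> 'a word set monoid" where
  "presented_group S R =
     \<lparr>carrier = lists (S \<times> UNIV) // pres_rel S R,
      mult = (\<lambda>A B. \<Union>u \<in> A. \<Union>v \<in> B. pres_rel S R `` {u @ v}),
      one = pres_rel S R `` {[]}\<rparr>"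

lemma equiv_pres_rel: "equiv (lists (S \<times> UNIV)) (pres_rel S R)"
proof -
  have "u \<in> lists (S \<times> UNIV) \<and> v \<in> lists (S \<times> UNIV)" if "(u, v) \<in> pres_rel S R" for u v
    using that by induction auto
  then show ?thesis
    by (auto simp: equiv_def refl_on_def sym_on_def trans_on_def
        intro: pres_rel.refl pres_rel.sym pres_rel.trans)
qed

lemma presented_group_mult:
  assumes "u \<in> lists (S \<times> UNIV)" "v \<in> lists (S \<times> UNIV)"
  shows "(pres_rel S R `` {u}) \<otimes>\<^bsub>presented_group S R\<^esub> (pres_rel S R `` {v}) = pres_rel S R `` {u @ v}"
proof -
  have "(\<lambda>u v. pres_rel S R `` {u @ v}) respects2 pres_rel S R"
    by (rule congruent2I'[OF equiv_class_eq[OF equiv_pres_rel]]) (rule pres_rel.append)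
  then show ?thesis
    using UN_equiv_class2[OF equiv_pres_rel equiv_pres_rel _ assms]
    by (simp add: presented_group_def)
qed

lemma group_presented_group: "group (presented_group S R)" (is "group ?G")
proof -
  let ?W = "lists (S \<times> (UNIV :: bool set))" and ?c = "\<lambda>u. pres_rel S R `` {u}"
  have carr: "carrier ?G = ?c ` ?W"
    by (auto simp: presented_group_def quotient_def)
  have one: "\<one>\<^bsub>?G\<^esub> = ?c []"
    by (simp add: presented_group_def)
  have inv: "\<exists>v \<in> ?W. (v @ u, []) \<in> pres_rel S R" if "u \<in> ?W" for u
    using that
  proof induction
    case Nil
    show ?case by (auto intro!: bexI[of _ "[]"] pres_rel.refl)
  next
    case (Cons a u)
    obtain x b where a: "a = (x, b)" "x \<in> S" using Cons.hyps by auto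
    obtain v where v: "v \<in> ?W" "(v @ u, []) \<in> pres_rel S R" using Cons.IH by blast
    have "([(x, \<not> b), (x, \<not> \<not> b)] @ u, [] @ u) \<in> pres_rel S R"
      using a Cons.hyps by (intro pres_rel.append pres_rel.cancel pres_rel.refl)
    then have "(v @ [(x, \<not> b), (x, b)] @ u, v @ u) \<in> pres_rel S R"
      using v by (intro pres_rel.append[OF pres_rel.refl]) auto
    then have "((v @ [(x, \<not> b)]) @ a # u, []) \<in> pres_rel S R"
      using v a by (auto intro: pres_rel.trans)
    then show ?case using v a by (intro bexI[of _ "v @ [(x, \<not> b)]"]) auto
  qed
  have carrE: thesis if "A \<in> carrier ?G" "\<And>u. u \<in> ?W \<Longrightarrow> A = ?c u \<Longrightarrow> thesis" for A thesis
    using that by (auto simp: carr)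
  obtain W where W: "W = ?W" by simp
  have W_simps: "[] \<in> W" "\<And>u v. u \<in> W \<Longrightarrow> v \<in> W \<Longrightarrow> u @ v \<in> W"
    "\<And>u. u \<in> W \<Longrightarrow> ?c u \<in> carrier ?G"
    "\<And>u v. u \<in> W \<Longrightarrow> v \<in> W \<Longrightarrow> ?c u \<otimes>\<^bsub>?G\<^esub> ?c v = ?c (u @ v)"
    by (auto simp: W carr presented_group_mult)
  show ?thesis
  proof (rule groupI)
    fix A assume "A \<in> carrier ?G"
    then obtain u where u: "u \<in> ?W" "A = ?c u" by (rule carrE)
    obtain v where v: "v \<in> ?W" "(v @ u, []) \<in> pres_rel S R" using inv u by blast
    have "?c v \<otimes>\<^bsub>?G\<^esub> A = \<one>\<^bsub>?G\<^esub>"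
      using u v by (simp add: presented_group_mult one equiv_class_eq[OF equiv_pres_rel])
    then show "\<exists>B \<in> carrier ?G. B \<otimes>\<^bsub>?G\<^esub> A = \<one>\<^bsub>?G\<^esub>"
      using v by (auto simp: carr)
  qed (auto elim!: carrE[folded W] simp: one W_simps)
qed

section \<open>The Yang--Baxter group and the injectivization\<close>

definition yb_relators :: "'a set \<Rightarrow> ('a \<times> 'a \<Rightarrow> 'a \<times> 'a) \<Rightarrow> ('a word \<times> 'a word) set" where
  "yb_relators X r =
     {([(x, True), (y, True)], [(lam r x y, True), (rho r y x, True)]) | x y. x \<in> X \<and> y \<in> X}"

definition yb_group :: "'a set \<Rightarrow> ('a \<times> 'a \<Rightarrow> 'a \<times> 'a) \<Rightarrow> 'a word set monoid" where
  "yb_group X r = presented_group X (yb_relators X r)"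

definition yb_can :: "'a set \<Rightarrow> ('a \<times> 'a \<Rightarrow> 'a \<times> 'a) \<Rightarrow> 'a \<Rightarrow> 'a word set" where
  "yb_can X r x = pres_rel X (yb_relators X r) `` {[(x, True)]}"

definition inj_set :: "'a set \<Rightarrow> ('a \<times> 'a \<Rightarrow> 'a \<times> 'a) \<Rightarrow> 'a word set set" where
  "inj_set X r = yb_can X r ` X"

text \<open>The map induced by \<open>r\<close>; that it is well defined is lemma \<open>inj_map_yb_can\<close> below.\<close>

definition inj_map ::
  "'a set \<Rightarrow> ('a \<times> 'a \<Rightarrow> 'a \<times> 'a) \<Rightarrow> 'a word set \<times> 'a word set \<Rightarrow> 'a word set \<times> 'a word set" where
  "inj_map X r = (\<lambda>(p, q). THE s. \<exists>x \<in> X. \<exists>y \<in> X. p = yb_can X r x \<and> q = yb_can X r y \<and>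
     s = (yb_can X r (lam r x y), yb_can X r (rho r y x)))"

text \<open>A family of permutations indexed by the generators that respects the defining relations
  takes equal values on generators which become equal in the presented group.\<close>

fun word_act :: "('a \<Rightarrow> 'b \<Rightarrow> 'b) \<Rightarrow> 'b set \<Rightarrow> 'a word \<Rightarrow> 'b \<Rightarrow> 'b" where
  "word_act f Z [] z = z"
| "word_act f Z ((x, b) # w) z = (if b then f x else inv_into Z (f x)) (word_act f Z w z)"

lemma word_act_append: "word_act f Z (u @ v) z = word_act f Z u (word_act f Z v z)"
  by (induction u) auto

lemma word_act_in:
  assumes "\<And>x. x \<in> S \<Longrightarrow> bij_betw (f x) Z Z" "u \<in> lists (S \<times> UNIV)" "z \<in> Z"
  shows "word_act f Z u z \<in> Z"
  using assms(2)
proof induction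
  case (Cons a u)
  then obtain x b where a: "a = (x, b)" "x \<in> S" by auto
  then show ?case
    using Cons assms(1)[OF a(2)] by (auto simp: bij_betw_def inv_into_into)
qed (use assms(3) in simp)

lemma word_act_cong:
  assumes bij: "\<And>x. x \<in> S \<Longrightarrow> bij_betw (f x) Z Z"
    and resp: "\<And>u v z. (u, v) \<in> R \<Longrightarrow> z \<in> Z \<Longrightarrow> word_act f Z u z = word_act f Z v z"
    and "(u, v) \<in> pres_rel S R" "z \<in> Z"
  shows "word_act f Z u z = word_act f Z v z"
  using assms(3,4)
proof (induction arbitrary: z)
  case (append u u' v v')
  have "v \<in> lists (S \<times> UNIV)"
    using append.hyps(2) equiv_pres_rel[of S R] by (blast dest: equiv_type)
  then have "word_act f Z v z \<in> Z"
    by (intro word_act_in[of S f Z] bij append.prems)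
  then show ?case using append.IH append.prems by (simp only: word_act_append)
next
  case (cancel x b)
  have "word_act f Z [(x, b), (x, \<not> b)] z = z"
    using bij_betw_inv_into_left[OF bij[OF cancel(1)] cancel(2)]
      bij_betw_inv_into_right[OF bij[OF cancel(1)] cancel(2)]
    by (cases b) simp_all
  then show ?case by simp
next
  case (rel u v)
  then show ?case using resp by blast
next
  case (sym u v)
  show ?case by (rule sym.IH[OF sym.prems, symmetric])
next
  case (trans u v w)
  show ?case by (rule HOL.trans[OF trans.IH(1)[OF trans.prems] trans.IH(2)[OF trans.prems]])
qed simp

context
  fixes X :: "'a set" and r
  assumes sol: "yb_solution X r"
begin

lemma yb_closed: "x \<in> X \<Longrightarrow> y \<in> X \<Longrightarrow> lam r x y \<in> X" "x \<in> X \<Longrightarrow> y \<in> X \<Longrightarrow> rho r y x \<in> X"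
  using sol unfolding yb_solution_def by (meson bij_betwE)+

lemma yb_bij:
  "x \<in> X \<Longrightarrow> bij_betw (lam r x) X X" "y \<in> X \<Longrightarrow> bij_betw (rho r y) X X"
  using sol by (auto simp: yb_solution_def)

lemma yb_braid:
  assumes "x \<in> X" "y \<in> X" "z \<in> X"
  shows "lam r x (lam r y z) = lam r (lam r x y) (lam r (rho r y x) z)"
    and "rho r (lam r (rho r y x) z) (lam r x y) = lam r (rho r (lam r y z) x) (rho r z y)"
    and "rho r z (rho r y x) = rho r (rho r z y) (rho r (lam r y z) x)"
proof -
  have "(x, y, z) \<in> X \<times> X \<times> X" using assms by simp
  then have "r12 r (r23 r (r12 r (x, y, z))) = r23 r (r12 r (r23 r (x, y, z)))"
    using sol unfolding yb_solution_def by blast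
  then have "(lam r (lam r x y) (lam r (rho r y x) z), rho r (lam r (rho r y x) z) (lam r x y),
      rho r z (rho r y x)) = (lam r x (lam r y z), lam r (rho r (lam r y z) x) (rho r z y),
      rho r (rho r z y) (rho r (lam r y z) x))"
    by (simp add: r12_def r23_def split_def prod_eq_iff)
  then show "lam r x (lam r y z) = lam r (lam r x y) (lam r (rho r y x) z)"
    "rho r (lam r (rho r y x) z) (lam r x y) = lam r (rho r (lam r y z) x) (rho r z y)"
    "rho r z (rho r y x) = rho r (rho r z y) (rho r (lam r y z) x)"
    unfolding prod.inject by metis+
qed

lemma yb_can_eqD:
  assumes "yb_can X r x = yb_can X r x'" "x' \<in> X"
  shows "([(x, True)], [(x', True)]) \<in> pres_rel X (yb_relators X r)"
  by (rule eq_equiv_class[OF _ equiv_pres_rel]) (use assms in \<open>auto simp: yb_can_def\<close>)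

lemma yb_can_lam:
  assumes "x \<in> X" "x' \<in> X" "yb_can X r x = yb_can X r x'" "y \<in> X"
  shows "lam r x y = lam r x' y"
proof -
  have "([(x, True)], [(x', True)]) \<in> pres_rel X (yb_relators X r)"
    using assms by (intro yb_can_eqD)
  then have "word_act (lam r) X [(x, True)] y = word_act (lam r) X [(x', True)] y"
    by (rule word_act_cong[rotated 2])
      (use assms in \<open>auto simp: yb_relators_def yb_bij intro: yb_braid(1)\<close>)
  then show ?thesis by simp
qed

lemma yb_can_rho:
  assumes "y \<in> X" "y' \<in> X" "yb_can X r y = yb_can X r y'" "x \<in> X"
  shows "rho r y x = rho r y' x"
proof -
  define f where "f = (\<lambda>y. inv_into X (rho r y))"
  have bij: "bij_betw (f y) X X" if "y \<in> X" for y
    unfolding f_def by (rule bij_betw_inv_into[OF yb_bij(2)[OF that]])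
  have fr: "f y (rho r y x) = x" "rho r y (f y x) = x" if "x \<in> X" "y \<in> X" for x y
    unfolding f_def
    by (rule bij_betw_inv_into_left[OF yb_bij(2)[OF that(2)] that(1)],
        rule bij_betw_inv_into_right[OF yb_bij(2)[OF that(2)] that(1)])
  have fX: "f y x \<in> X" if "x \<in> X" "y \<in> X" for x y
    using bij that by (meson bij_betwE)
  have hom: "f y (f z w) = f (lam r y z) (f (rho r z y) w)" if "y \<in> X" "z \<in> X" "w \<in> X" for y z w
  proof -
    define a where "a = f y (f z w)"
    have a: "a \<in> X" by (simp add: a_def fX that)
    have "w = rho r z (rho r y a)" using that by (simp only: a_def fr fX)
    also have "\<dots> = rho r (rho r z y) (rho r (lam r y z) a)" using a that by (intro yb_braid(3))
    finally have "f (lam r y z) (f (rho r z y) w) = a"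
      by (simp add: fr a yb_closed that)
    then show ?thesis by (simp add: a_def)
  qed
  have eq: "([(y, True)], [(y', True)]) \<in> pres_rel X (yb_relators X r)"
    using assms by (intro yb_can_eqD)
  have "f y w = f y' w" if "w \<in> X" for w
  proof -
    have "word_act f X [(y, True)] w = word_act f X [(y', True)] w"
      by (rule word_act_cong[OF bij _ eq that]) (auto simp: yb_relators_def hom[symmetric])
    then show ?thesis by simp
  qed
  then have "f y (rho r y' x) = f y' (rho r y' x)"
    using assms yb_closed by blast
  also have "\<dots> = x" using assms by (intro fr)
  finally have "rho r y (f y (rho r y' x)) = rho r y x" by simp
  then show ?thesis using assms fr(2)[of "rho r y' x" y] yb_closed by simp
qed

lemma yb_can_mult:
  assumes "x \<in> X" "y \<in> X"
  shows "yb_can X r x \<otimes>\<^bsub>yb_group X r\<^esub> yb_can X r y =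
    yb_can X r (lam r x y) \<otimes>\<^bsub>yb_group X r\<^esub> yb_can X r (rho r y x)"
proof -
  have "([(x, True), (y, True)], [(lam r x y, True), (rho r y x, True)]) \<in> pres_rel X (yb_relators X r)"
    using assms yb_closed by (intro pres_rel.rel) (auto simp: yb_relators_def)
  then show ?thesis
    using assms yb_closed
    by (simp add: yb_group_def yb_can_def presented_group_mult equiv_class_eq[OF equiv_pres_rel])
qed

lemma yb_can_well_defined:
  assumes "x \<in> X" "x' \<in> X" "y \<in> X" "y' \<in> X"
    and eq: "yb_can X r x = yb_can X r x'" "yb_can X r y = yb_can X r y'"
  shows "yb_can X r (lam r x y) = yb_can X r (lam r x' y')"
    and "yb_can X r (rho r y x) = yb_can X r (rho r y' x')"
proof -
  let ?G = "yb_group X r" and ?i = "yb_can X r"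
  interpret group ?G by (simp add: yb_group_def group_presented_group)
  have car: "?i z \<in> carrier ?G" if "z \<in> X" for z
    using that by (auto simp: yb_can_def yb_group_def presented_group_def quotient_def)
  have l: "lam r x' z = lam r x z" and rr: "rho r y' z = rho r y z" if "z \<in> X" for z
    using yb_can_lam[OF assms(1,2) eq(1) that] yb_can_rho[OF assms(3,4) eq(2) that] by simp_all
  have "?i (lam r x y) \<otimes>\<^bsub>?G\<^esub> ?i (rho r y x) = ?i (lam r x y') \<otimes>\<^bsub>?G\<^esub> ?i (rho r y x)"
    using yb_can_mult[of x y] yb_can_mult[of x y'] assms rr[of x] by simp
  then show "?i (lam r x y) = ?i (lam r x' y')"
    using l assms car yb_closed by (simp add: right_cancel)
  have "?i (lam r x y) \<otimes>\<^bsub>?G\<^esub> ?i (rho r y x) = ?i (lam r x y) \<otimes>\<^bsub>?G\<^esub> ?i (rho r y x')"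
    using yb_can_mult[of x y] yb_can_mult[of x' y] assms l[of y] by simp
  then show "?i (rho r y x) = ?i (rho r y' x')"
    using rr assms car yb_closed by simp
qed

lemma inj_map_yb_can:
  assumes "x \<in> X" "y \<in> X"
  shows "inj_map X r (yb_can X r x, yb_can X r y) = (yb_can X r (lam r x y), yb_can X r (rho r y x))"
  unfolding inj_map_def prod.case
proof (rule the_equality)
  show "\<exists>x' \<in> X. \<exists>y' \<in> X. yb_can X r x = yb_can X r x' \<and> yb_can X r y = yb_can X r y' \<and>
      (yb_can X r (lam r x y), yb_can X r (rho r y x)) =
      (yb_can X r (lam r x' y'), yb_can X r (rho r y' x'))"
    using assms by blast
next
  fix s
  assume "\<exists>x' \<in> X. \<exists>y' \<in> X. yb_can X r x = yb_can X r x' \<and> yb_can X r y = yb_can X r y' \<and>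
      s = (yb_can X r (lam r x' y'), yb_can X r (rho r y' x'))"
  then obtain x' y' where *: "x' \<in> X" "y' \<in> X" "yb_can X r x = yb_can X r x'"
    "yb_can X r y = yb_can X r y'" "s = (yb_can X r (lam r x' y'), yb_can X r (rho r y' x'))"
    by blast
  show "s = (yb_can X r (lam r x y), yb_can X r (rho r y x))"
    unfolding *(5) using yb_can_well_defined[OF assms(1) *(1) assms(2) *(2-4)] by simp
qed

lemma yb_solution_inj: "yb_solution (inj_set X r) (inj_map X r)"
proof -
  let ?i = "yb_can X r" and ?I = "inj_set X r" and ?s = "inj_map X r"
  have fin: "finite ?I" and ne: "?I \<noteq> {}"
    using sol by (auto simp: inj_set_def yb_solution_def)
  have surj_bij: "bij_betw f A A" if "finite A" "f ` A = A" for f :: "'c \<Rightarrow> 'c" and A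
    using that by (simp add: bij_betw_def eq_card_imp_inj_on)
  have rX: "r ` (X \<times> X) = X \<times> X"
    using sol by (simp add: yb_solution_def bij_betw_def)
  have "?s ` (?I \<times> ?I) = map_prod ?i ?i ` r ` (X \<times> X)"
  proof -
    have "?I \<times> ?I = map_prod ?i ?i ` (X \<times> X)" by (auto simp: inj_set_def)
    then show ?thesis
      by (auto simp: image_image inj_map_yb_can map_prod_def case_prod_unfold intro!: image_cong)
  qed
  also have "\<dots> = ?I \<times> ?I" by (auto simp: rX inj_set_def)
  finally have b: "bij_betw ?s (?I \<times> ?I) (?I \<times> ?I)" using fin by (intro surj_bij) auto
  have l: "bij_betw (lam ?s p) ?I ?I" if p: "p \<in> ?I" for p
  proof -
    obtain x where x: "x \<in> X" "p = ?i x" using p by (auto simp: inj_set_def)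
    have "lam ?s p ` ?I = ?i ` lam r x ` X"
      using x by (simp add: inj_set_def image_image inj_map_yb_can)
    then show ?thesis using fin yb_bij(1)[OF x(1)] by (intro surj_bij) (auto simp: inj_set_def bij_betw_def)
  qed
  have q: "bij_betw (rho ?s p) ?I ?I" if p: "p \<in> ?I" for p
  proof -
    obtain y where y: "y \<in> X" "p = ?i y" using p by (auto simp: inj_set_def)
    have "rho ?s p ` ?I = ?i ` rho r y ` X"
      using y by (simp add: inj_set_def image_image inj_map_yb_can)
    then show ?thesis using fin yb_bij(2)[OF y(1)] by (intro surj_bij) (auto simp: inj_set_def bij_betw_def)
  qed
  have "r12 ?s (r23 ?s (r12 ?s t)) = r23 ?s (r12 ?s (r23 ?s t))" if t: "t \<in> ?I \<times> ?I \<times> ?I" for t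
  proof -
    obtain x y z where "x \<in> X" "y \<in> X" "z \<in> X" "t = (?i x, ?i y, ?i z)"
      using t by (auto simp: inj_set_def)
    then show ?thesis
      using yb_braid[of x y z] by (simp add: r12_def r23_def inj_map_yb_can yb_closed)
  qed
  then show ?thesis using fin ne b l q by (simp add: yb_solution_def)
qed

end

end

theory Submission imports Defs begin

text \<open>A decomposition of a solution into \<open>n\<close> blocks is the same thing as a colouring of its points
  by exactly \<open>n\<close> colours for which \<open>r\<close> moves the colours like the flip: \<open>lam r x y\<close> has the
  colour of \<open>y\<close>, and \<open>rho r y x\<close> has the colour of \<open>x\<close> (\<open>n_decomposable_iff_colouring\<close>).
  In this form the theorem says that such colourings of \<open>X\<close> are the same as such colourings of the
  injectivization. A colouring of the injectivization pulls back along the canonical map. For the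
  other direction a colouring of \<open>X\<close> has to be constant on the fibres of the canonical map. This
  holds because, for each colour \<open>k\<close>, the number of letters of colour \<open>k\<close> in a word does not change
  under the relations \<open>x \<circ> y = lam r x y \<circ> rho r y x\<close>, so that it defines a homomorphism from the
  Yang--Baxter group to the integers, and these homomorphisms tell generators of different colours
  apart (\<open>flip_colouring_yb_can\<close>).

  Decomposability asks for less than \<open>2\<close>-decomposability, since nothing is required of \<open>r\<close> on mixed
  pairs. On a finite solution the two notions agree: the bijection \<open>lam r x\<close> maps the block of \<open>x\<close>
  into itself, hence onto itself, hence it also preserves the complement; the same holds for the
  maps \<open>rho r y\<close> (\<open>decomposable_iff_2_decomposable\<close>).\<close>

definition flip_colouring :: "'a set \<Rightarrow> ('a \<times> 'a \<Rightarrow> 'a \<times> 'a) \<Rightarrow> ('a \<Rightarrow> 'c) \<Rightarrow> bool" where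
  "flip_colouring X r c \<longleftrightarrow> (\<forall>x \<in> X. \<forall>y \<in> X. c (lam r x y) = c y \<and> c (rho r y x) = c x)"

lemma flip_colouring_class_image:
  assumes sol: "yb_solution X r" and c: "flip_colouring X r c"
  shows "r ` ({x \<in> X. c x = i} \<times> {x \<in> X. c x = j}) \<subseteq> {x \<in> X. c x = j} \<times> {x \<in> X. c x = i}"
proof (rule image_subsetI)
  fix p assume "p \<in> {x \<in> X. c x = i} \<times> {x \<in> X. c x = j}"
  then obtain x y where "x \<in> X" "c x = i" "y \<in> X" "c y = j" "p = (x, y)" by blast
  then show "r p \<in> {x \<in> X. c x = j} \<times> {x \<in> X. c x = i}"
    using c yb_closed[OF sol, of x y] by (simp add: flip_colouring_def mem_Times_iff)
qed

text \<open>The colour classes and the blocks of a decomposition correspond to each other. The inclusion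
  of \<open>r ` (P i \<times> P j)\<close> in \<open>P j \<times> P i\<close> is \<open>flip_colouring_class_image\<close>; it is an equality since \<open>r\<close> is
  injective and the two products have the same finite cardinality.\<close>

lemma n_decomposable_iff_colouring:
  assumes sol: "yb_solution X r"
  shows "n_decomposable n X r \<longleftrightarrow> (\<exists>c :: 'a \<Rightarrow> nat. c ` X = {1..n} \<and> flip_colouring X r c)"
proof
  assume "n_decomposable n X r"
  then obtain P where sub: "\<And>i. i \<in> {1..n} \<Longrightarrow> subsolution (P i) X r"
    and part: "partition_on X (P ` {1..n})" and inj: "inj_on P {1..n}"
    and flip: "\<And>i j. i \<in> {1..n} \<Longrightarrow> j \<in> {1..n} \<Longrightarrow> r ` (P i \<times> P j) = P j \<times> P i"
    unfolding n_decomposable_def by metis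
  have unique: "i = j" if "i \<in> {1..n}" "j \<in> {1..n}" "x \<in> P i" "x \<in> P j" for i j x
  proof (rule ccontr)
    assume "i \<noteq> j"
    then have "P i \<noteq> P j" using inj that(1,2) by (meson inj_onD)
    then have "P i \<inter> P j = {}"
      using partition_onD2[OF part] that(1,2) by (simp add: disjoint_def)
    then show False using that(3,4) by blast
  qed
  define c where "c = (\<lambda>x. THE i. i \<in> {1..n} \<and> x \<in> P i)"
  have c_eq: "c x = i" if "i \<in> {1..n}" "x \<in> P i" for i x
    unfolding c_def using that unique by blast
  have block: "\<exists>i \<in> {1..n}. x \<in> P i" if "x \<in> X" for x
    using partition_onD1[OF part] that by auto
  have "c ` X = {1..n}"
  proof
    have "c x \<in> {1..n}" if "x \<in> X" for x using block[OF that] c_eq by auto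
    then show "c ` X \<subseteq> {1..n}" by (rule image_subsetI)
    show "{1..n} \<subseteq> c ` X"
    proof
      fix i assume i: "i \<in> {1..n}"
      then obtain x where "x \<in> P i" "x \<in> X" using sub[OF i] unfolding subsolution_def by blast
      then show "i \<in> c ` X" using c_eq[OF i] by (metis imageI)
    qed
  qed
  moreover have "flip_colouring X r c"
    unfolding flip_colouring_def
  proof (intro ballI)
    fix x y assume "x \<in> X" "y \<in> X"
    then obtain i j where i: "i \<in> {1..n}" "x \<in> P i" and j: "j \<in> {1..n}" "y \<in> P j"
      using block by meson
    then have "r (x, y) \<in> P j \<times> P i" using flip[OF i(1) j(1)] by blast
    then show "c (lam r x y) = c y \<and> c (rho r y x) = c x"
      using i j c_eq by (simp add: mem_Times_iff)
  qed
  ultimately show "\<exists>c :: 'a \<Rightarrow> nat. c ` X = {1..n} \<and> flip_colouring X r c" by blast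
next
  assume "\<exists>c :: 'a \<Rightarrow> nat. c ` X = {1..n} \<and> flip_colouring X r c"
  then obtain c :: "'a \<Rightarrow> nat" where im: "c ` X = {1..n}" and c: "flip_colouring X r c"
    by blast
  define P where "P = (\<lambda>i. {x \<in> X. c x = i})"
  have PX: "P i \<subseteq> X" for i by (auto simp: P_def)
  have ne: "P i \<noteq> {}" if "i \<in> {1..n}" for i
  proof -
    have "i \<in> c ` X" using that im by simp
    then show ?thesis unfolding P_def by blast
  qed
  have flip: "r ` (P i \<times> P j) = P j \<times> P i" for i j
  proof (rule card_subset_eq)
    have fin: "finite X" and "inj_on r (X \<times> X)"
      using sol by (auto simp: yb_solution_def bij_betw_def)
    then show "finite (P j \<times> P i)" using PX by (meson finite_SigmaI finite_subset)
    show "r ` (P i \<times> P j) \<subseteq> P j \<times> P i"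
      unfolding P_def by (rule flip_colouring_class_image[OF sol c])
    have "inj_on r (P i \<times> P j)"
      by (rule inj_on_subset[OF \<open>inj_on r (X \<times> X)\<close>]) (use PX in blast)
    then show "card (r ` (P i \<times> P j)) = card (P j \<times> P i)"
      by (simp add: card_image card_cartesian_product)
  qed
  have "partition_on X (P ` {1..n})"
  proof (rule partition_onI)
    show "\<Union> (P ` {1..n}) = X" using im by (auto simp: P_def)
    show "{} \<notin> P ` {1..n}"
    proof
      assume "{} \<in> P ` {1..n}"
      then show False using ne by (metis imageE)
    qed
  qed (auto simp: P_def disjnt_def)
  moreover have "inj_on P {1..n}"
  proof (rule inj_onI)
    fix i j assume "i \<in> {1..n}" "P i = P j"
    then obtain x where "x \<in> P i" "x \<in> P j" using ne by blast
    then show "i = j" by (simp add: P_def)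
  qed
  ultimately show "n_decomposable n X r"
    unfolding n_decomposable_def subsolution_def using PX ne flip by (intro exI[of _ P]) simp
qed

text \<open>The element \<open>x\<close> acts on the integers as translation by \<open>1\<close> if it has the colour of \<open>x'\<close> and by
  \<open>0\<close> otherwise. Both sides of a defining relation translate by the same amount, so that generators
  with equal images in the Yang--Baxter group act equally.\<close>

lemma flip_colouring_yb_can:
  assumes c: "flip_colouring X r c"
    and x: "x \<in> X" "x' \<in> X" "yb_can X r x = yb_can X r x'"
  shows "c x = c x'"
proof -
  define f :: "'a \<Rightarrow> int \<Rightarrow> int" where "f = (\<lambda>y z. z + (if c y = c x' then 1 else 0))"
  have rel: "([(x, True)], [(x', True)]) \<in> pres_rel X (yb_relators X r)"
    by (rule eq_equiv_class[OF _ equiv_pres_rel]) (use x in \<open>auto simp: yb_can_def\<close>)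
  have bij: "bij_betw (f y) UNIV UNIV" for y
    by (rule bij_betwI[where g = "\<lambda>z. z - (if c y = c x' then 1 else 0)"]) (auto simp: f_def)
  have "word_act f UNIV [(x, True)] 0 = word_act f UNIV [(x', True)] 0"
    by (rule word_act_cong[OF bij _ rel])
      (use c in \<open>auto simp: yb_relators_def f_def flip_colouring_def\<close>)
  then show ?thesis by (simp add: f_def split: if_splits)
qed

lemma flip_colouring_inj:
  assumes sol: "yb_solution X r"
  shows "flip_colouring (inj_set X r) (inj_map X r) d \<longleftrightarrow> flip_colouring X r (d \<circ> yb_can X r)"
  by (simp add: flip_colouring_def inj_set_def inj_map_yb_can[OF sol])

lemma n_decomposable_inj_iff:
  assumes sol: "yb_solution X r"
  shows "n_decomposable n X r \<longleftrightarrow> n_decomposable n (inj_set X r) (inj_map X r)"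
proof -
  have "(\<exists>c :: 'a \<Rightarrow> nat. c ` X = {1..n} \<and> flip_colouring X r c) \<longleftrightarrow>
    (\<exists>d. d ` inj_set X r = {1..n} \<and> flip_colouring (inj_set X r) (inj_map X r) d)" (is "?L \<longleftrightarrow> ?R")
  proof
    assume ?L
    then obtain c :: "'a \<Rightarrow> nat" where c: "c ` X = {1..n}" "flip_colouring X r c" by blast
    define d where "d = c \<circ> inv_into X (yb_can X r)"
    have d: "d (yb_can X r x) = c x" if "x \<in> X" for x
      unfolding d_def comp_def using that
      by (intro flip_colouring_yb_can[OF c(2)]) (simp_all add: inv_into_into f_inv_into_f)
    have "d ` inj_set X r = {1..n}"
      using c(1) d by (simp add: inj_set_def image_image)
    moreover have "flip_colouring X r (d \<circ> yb_can X r)"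
      using c(2) d yb_closed[OF sol] by (simp add: flip_colouring_def)
    ultimately show ?R using flip_colouring_inj[OF sol] by blast
  next
    assume ?R
    then obtain d where "d ` inj_set X r = {1..n}" "flip_colouring X r (d \<circ> yb_can X r)"
      using flip_colouring_inj[OF sol] by blast
    then show ?L by (intro exI[of _ "d \<circ> yb_can X r"]) (simp add: inj_set_def image_comp)
  qed
  then show ?thesis
    by (simp only: n_decomposable_iff_colouring[OF sol]
        n_decomposable_iff_colouring[OF yb_solution_inj[OF sol]])
qed

lemma bij_betw_finite_invariant_iff:
  assumes "bij_betw f X X" "finite X" "A \<subseteq> X" "f ` A \<subseteq> A" "x \<in> X"
  shows "f x \<in> A \<longleftrightarrow> x \<in> A"
proof
  have inj: "inj_on f X" using assms(1) by (rule bij_betw_imp_inj_on)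
  have "f ` A = A"
    using assms(2-4) inj_on_subset[OF inj] by (intro endo_inj_surj) (auto dest: finite_subset)
  then show "x \<in> A" if "f x \<in> A"
    using that inj_on_image_mem_iff[OF inj assms(5,3)] by simp
qed (use assms(4) in blast)

lemma decomposable_iff_2_decomposable:
  assumes sol: "yb_solution X r"
  shows "decomposable X r \<longleftrightarrow> n_decomposable 2 X r"
proof -
  have two: "{1..2} = {1, 2 :: nat}" by auto
  have "decomposable X r \<longleftrightarrow> (\<exists>c :: 'a \<Rightarrow> nat. c ` X = {1..2} \<and> flip_colouring X r c)"
  proof
    assume "decomposable X r"
    then obtain Y Z where X: "X = Y \<union> Z" "Y \<inter> Z = {}" "Y \<noteq> {}" "Z \<noteq> {}"
      and Y: "r ` (Y \<times> Y) \<subseteq> Y \<times> Y" and Z: "r ` (Z \<times> Z) \<subseteq> Z \<times> Z"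
      unfolding decomposable_def by blast
    have fin: "finite X" using sol by (simp add: yb_solution_def)
    have stable: "(lam r a x \<in> A \<longleftrightarrow> x \<in> A) \<and> (rho r a x \<in> A \<longleftrightarrow> x \<in> A)"
      if A: "r ` (A \<times> A) \<subseteq> A \<times> A" "A \<subseteq> X" and "a \<in> A" "x \<in> X" for A a x
    proof -
      have "r (a, b) \<in> A \<times> A" "r (b, a) \<in> A \<times> A" if "b \<in> A" for b
        using A(1) \<open>a \<in> A\<close> that by blast+
      then have "lam r a ` A \<subseteq> A" "rho r a ` A \<subseteq> A" by (auto simp: mem_Times_iff)
      moreover have "a \<in> X" using that by blast
      ultimately show ?thesis
        using bij_betw_finite_invariant_iff[OF yb_bij(1)[OF sol] fin A(2)]
          bij_betw_finite_invariant_iff[OF yb_bij(2)[OF sol] fin A(2)] \<open>x \<in> X\<close> by simp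
    qed
    define c :: "'a \<Rightarrow> nat" where "c x = (if x \<in> Y then 1 else 2)" for x
    have c_iff: "c u = c v \<longleftrightarrow> (u \<in> Y \<longleftrightarrow> v \<in> Y)" for u v
      by (simp add: c_def)
    have act: "(lam r a x \<in> Y \<longleftrightarrow> x \<in> Y) \<and> (rho r a x \<in> Y \<longleftrightarrow> x \<in> Y)"
      if "a \<in> X" "x \<in> X" for a x
    proof (cases "a \<in> Y")
      case True
      then show ?thesis using stable[OF Y _ _ \<open>x \<in> X\<close>] X(1) by simp
    next
      case False
      then have "(lam r a x \<in> Z \<longleftrightarrow> x \<in> Z) \<and> (rho r a x \<in> Z \<longleftrightarrow> x \<in> Z)"
        using stable[OF Z _ _ \<open>x \<in> X\<close>] X(1) \<open>a \<in> X\<close> by simp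
      moreover have "u \<in> Y \<longleftrightarrow> u \<notin> Z" if "u \<in> X" for u
        using that X(1,2) by blast
      ultimately show ?thesis
        using that yb_closed[OF sol] by simp
    qed
    have "c ` X = {1..2}"
    proof -
      have "c ` Y = {1}" "c ` Z = {2}" using X(2-4) by (auto simp: c_def)
      then have "c ` (Y \<union> Z) = {1, 2}" unfolding image_Un by auto
      then show ?thesis unfolding X(1) two .
    qed
    moreover have "flip_colouring X r c"
      using act by (simp add: flip_colouring_def c_iff)
    ultimately show "\<exists>c :: 'a \<Rightarrow> nat. c ` X = {1..2} \<and> flip_colouring X r c" by blast
  next
    assume "\<exists>c :: 'a \<Rightarrow> nat. c ` X = {1..2} \<and> flip_colouring X r c"
    then obtain c :: "'a \<Rightarrow> nat" where im: "c ` X = {1, 2}" and c: "flip_colouring X r c"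
      unfolding two by blast
    define Y Z where "Y = {x \<in> X. c x = 1}" and "Z = {x \<in> X. c x = 2}"
    have "1 \<in> c ` X" "2 \<in> c ` X" using im by auto
    then have "Y \<noteq> {}" and "Z \<noteq> {}" by (auto simp: Y_def Z_def image_iff)
    moreover have "c x = 1 \<or> c x = 2" if "x \<in> X" for x
      using imageI[OF that, of c] im by simp
    then have "X = Y \<union> Z" and "Y \<inter> Z = {}" by (auto simp: Y_def Z_def)
    moreover have "r ` (Y \<times> Y) \<subseteq> Y \<times> Y" "r ` (Z \<times> Z) \<subseteq> Z \<times> Z"
      unfolding Y_def Z_def by (rule flip_colouring_class_image[OF sol c])+
    ultimately show "decomposable X r"
      unfolding decomposable_def by (intro exI conjI)
  qed
  then show ?thesis by (simp only: n_decomposable_iff_colouring[OF sol])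
qed

theorem theorem3p8:
  fixes X :: "'a set" and r :: "'a \<times> 'a \<Rightarrow> 'a \<times> 'a"
  assumes "yb_solution X r"
  shows "(\<forall>n \<ge> 1. n_decomposable n X r \<longleftrightarrow> n_decomposable n (inj_set X r) (inj_map X r)) \<and>
         (decomposable X r \<longleftrightarrow> decomposable (inj_set X r) (inj_map X r))"
  using n_decomposable_inj_iff[OF assms] decomposable_iff_2_decomposable[OF assms]
    decomposable_iff_2_decomposable[OF yb_solution_inj[OF assms]] by blast

end
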